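(* Up to isomorphism, the path $P_3$ is the only tree that is perfect for the stripe-game with Maximizer responding (and Minimizer initiating).
   Context: Graphs are finite, simple and undirected; a tree has at least one vertex. $P_3$ is the path on three vertices; copies of $P_3$ in a graph are subgraphs, not necessarily induced. The stripe-game on a graph $G$ is played by two players, Maximizer and Minimizer; throughout the game one of them is the initiator and the other is the responder. In each round, the initiator chooses a vertex $v$ of the current graph such that the current graph contains at least one copy of $P_3$ with $v$ as an end-vertex; the responder then chooses one copy of $P_3$ in the current graph with $v$ as an end-vertex; the three vertices of that copy are removed, and the next round is played on the subgraph induced by the remaining vertices. The game ends when the remaining graph contains no copy of $P_3$. Maximizer tries to maximize, and Minimizer tries to minimize, the number of copies of $P_3$ taken. The value of the game is the number of copies taken under optimal play by both players. A graph is perfect (for a given version of the game) if under optimal play all vertices are taken, i.e. the value of the game equals $|V(G)|/3$. *)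

theory Defs
  imports "Graph_Theory.Graph_Theory"
begin

text \<open>
  Finite simple undirected graphs are rendered by the library locale \<^locale>\<open>graph\<close>:
  finite symmetric digraphs without loops or parallel arcs, each undirected edge being a
  pair of opposite arcs.
\<close>

text \<open>
  The library's own \<open>tree\<close> cannot be used: in a symmetric digraph an arc followed by its
  reverse is already a \<open>cycle\<close>. Excluding the closed walks of length 2 leaves exactly the
  cycles of the undirected graph. \<^const>\<open>connected\<close> includes nonemptiness.
\<close>

definition undirected_tree :: "('a, 'b) pre_digraph \<Rightarrow> bool" where
  "undirected_tree G \<longleftrightarrow>
     graph G \<and> connected G \<and> \<not> (\<exists>c. pre_digraph.cycle G c \<and> length c \<ge> 3)"

definition P3 :: "nat pair_pre_digraph" where
  "P3 = \<lparr> pverts = {0, 1, 2}, parcs = {(0, 1), (1, 0), (1, 2), (2, 1)} \<rparr>"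

text \<open>
  A copy of the three-vertex path with end-vertex \<open>v\<close> is given by its centre \<open>w\<close> and its
  other end-vertex \<open>x\<close>; \<open>v\<close> and \<open>x\<close> may be adjacent.
\<close>

definition p3_from :: "('a, 'b) pre_digraph \<Rightarrow> 'a \<Rightarrow> ('a \<times> 'a) set" where
  "p3_from G v = {(w, x). v \<rightarrow>\<^bsub>G\<^esub> w \<and> w \<rightarrow>\<^bsub>G\<^esub> x \<and> x \<noteq> v}"

definition p3_ends :: "('a, 'b) pre_digraph \<Rightarrow> 'a set" where
  "p3_ends G = {v \<in> verts G. p3_from G v \<noteq> {}}"

datatype player = Maximizer | Minimizer

fun opponent :: "player \<Rightarrow> player" where
  "opponent Maximizer = Minimizer"
| "opponent Minimizer = Maximizer"

fun optimum :: "player \<Rightarrow> nat set \<Rightarrow> nat" where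
  "optimum Maximizer A = Max A"
| "optimum Minimizer A = Min A"

text \<open>
  Backward induction; the first argument is the initiator, who optimizes over the vertex
  \<open>v\<close>, while the opponent responds by optimizing over the copies with end-vertex \<open>v\<close>.
  The finiteness guard only makes the recursion total.
\<close>

function stripe_value :: "player \<Rightarrow> ('a, 'b) pre_digraph \<Rightarrow> nat" where
  "stripe_value initiator G =
     (if finite (verts G) \<and> p3_ends G \<noteq> {} then
        optimum initiator
          ((\<lambda>v. optimum (opponent initiator)
             ((\<lambda>(w, x). 1 + stripe_value initiator (G \<restriction> (verts G - {v, w, x}))) ` p3_from G v))
           ` p3_ends G)
      else 0)"
  by pat_completeness auto
termination
proof (relation "measure (\<lambda>(_, G). card (verts G))", goal_cases)
  case (2 initiator G v z w x)
  then have "verts G - {v, w, x} \<subset> verts G" and "finite (verts G)"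
    by (auto simp: p3_ends_def)
  then show ?case
    by (simp add: psubset_card_mono)
qed simp

declare stripe_value.simps [simp del]

definition stripe_perfect :: "player \<Rightarrow> ('a, 'b) pre_digraph \<Rightarrow> bool" where
  "stripe_perfect initiator G \<longleftrightarrow> real (stripe_value initiator G) = real (card (verts G)) / 3"

end

theory Submission
  imports Defs
begin

text \<open>
  The proof compares the game with tilings of the vertex set by copies of \<open>P\<^sub>3\<close>. If all vertices
  are taken, then the copies taken form a tiling; and if Minimizer initiates, this must happen
  whatever vertex is named first. So in a perfect graph every vertex that is an end of some
  copy of \<open>P\<^sub>3\<close> is also the end of a tile in some tiling (\<open>minimizer_names_tile_end\<close>).

  A tree has at most one tiling: removing an edge \<open>a - c\<close> splits it into two sides, every tile
  that avoids this edge lies in one side, and hence the edge belongs to a tile if and only if the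
  number of vertices on a side is not divisible by 3. In particular the centre of a tile is never
  the end of a tile in another tiling (\<open>tile_centre_not_tile_end\<close>). If the tree has further
  vertices besides the tile, the centre is nevertheless an end of some copy of \<open>P\<^sub>3\<close>
  (\<open>tile_centre_in_p3_ends\<close>). Naming it, Minimizer spoils perfection in the first round.
  Therefore a perfect tree consists of a single tile.
\<close>

section \<open>Tilings by paths on three vertices\<close>

inductive P3_tileable :: "('a \<times> 'a) set \<Rightarrow> 'a set \<Rightarrow> bool" for R where
  P3_tileable_empty: "P3_tileable R {}"
| P3_tileable_insert: "P3_tileable R V"
    if "(v, w) \<in> R" "(w, x) \<in> R" "x \<noteq> v" "{v, w, x} \<subseteq> V" "P3_tileable R (V - {v, w, x})"

text \<open>
  Each tile is connected, so it cannot meet both \<open>S\<close> and its complement without using an edge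
  between them.
\<close>

lemma P3_tileable_card_closed:
  assumes "P3_tileable R V" and "finite V" and "irrefl R"
    and "\<And>u v. (u, v) \<in> R \<Longrightarrow> u \<in> V \<Longrightarrow> v \<in> V \<Longrightarrow> u \<in> S \<longleftrightarrow> v \<in> S"
  shows "3 dvd card (V \<inter> S)"
  using assms
proof (induction rule: P3_tileable.induct)
  case P3_tileable_empty
  then show ?case by simp
next
  case (P3_tileable_insert v w x V)
  let ?T = "{v, w, x}"
  have IH: "3 dvd card ((V - ?T) \<inter> S)"
    using P3_tileable_insert.prems by (intro P3_tileable_insert.IH) auto
  have sides: "v \<in> S \<longleftrightarrow> w \<in> S" "w \<in> S \<longleftrightarrow> x \<in> S"
    using P3_tileable_insert by auto
  have "v \<noteq> w" "w \<noteq> x"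
    using P3_tileable_insert by (auto simp: irrefl_def)
  then have "card ?T = 3"
    using \<open>x \<noteq> v\<close> by auto
  moreover have "?T \<inter> S = ?T \<or> ?T \<inter> S = {}"
    using sides by auto
  ultimately have "3 dvd card (?T \<inter> S)"
    by auto
  moreover have "V \<inter> S = ((V - ?T) \<inter> S) \<union> (?T \<inter> S)"
    using P3_tileable_insert.hyps by auto
  then have "card (V \<inter> S) = card ((V - ?T) \<inter> S) + card (?T \<inter> S)"
    using \<open>finite V\<close> by (simp only:) (intro card_Un_disjoint; auto)
  ultimately show ?case
    using IH by simp
qed

lemma P3_tileable_neighbour:
  assumes "P3_tileable R V" and "sym R" and "z \<in> V"
  shows "\<exists>y \<in> V. (z, y) \<in> R"
  using assms
proof (induction rule: P3_tileable.induct)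
  case (P3_tileable_insert v w x V)
  then show ?case
    by (cases "z \<in> {v, w, x}") (auto dest: symD)
qed simp

section \<open>Values of the game and tilings\<close>

lemma optimum_mem:
  assumes "finite A" and "A \<noteq> {}"
  shows "optimum p A \<in> A"
  using assms by (cases p) auto

lemma finite_p3_ends:
  assumes "finite (verts G)"
  shows "finite (p3_ends G)"
  using assms by (simp add: p3_ends_def)

lemma finite_p3_from:
  assumes "wf_digraph G" and "finite (verts G)"
  shows "finite (p3_from G v)"
proof (rule finite_subset)
  show "p3_from G v \<subseteq> verts G \<times> verts G"
    using assms by (auto simp: p3_from_def dest: wf_digraph.adj_in_verts)
qed (use assms in auto)

lemma responder_choice:
  assumes "wf_digraph G" and "finite (verts G)" and "v \<in> p3_ends G"
  shows "\<exists>(w, x) \<in> p3_from G v.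
    optimum q ((\<lambda>(w, x). 1 + stripe_value p (G \<restriction> (verts G - {v, w, x}))) ` p3_from G v)
      = 1 + stripe_value p (G \<restriction> (verts G - {v, w, x}))"
proof -
  let ?A = "(\<lambda>(w, x). 1 + stripe_value p (G \<restriction> (verts G - {v, w, x}))) ` p3_from G v"
  have "optimum q ?A \<in> ?A"
    using assms finite_p3_from[OF assms(1,2)] by (intro optimum_mem) (auto simp: p3_ends_def)
  then show ?thesis
    by auto
qed

lemma stripe_value_attained:
  assumes "wf_digraph G" and "finite (verts G)" and "p3_ends G \<noteq> {}"
  shows "\<exists>v w x. (w, x) \<in> p3_from G v \<and>
    stripe_value p G = 1 + stripe_value p (G \<restriction> (verts G - {v, w, x}))"
proof -
  let ?f = "\<lambda>v. optimum (opponent p)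
    ((\<lambda>(w, x). 1 + stripe_value p (G \<restriction> (verts G - {v, w, x}))) ` p3_from G v)"
  have "stripe_value p G = optimum p (?f ` p3_ends G)"
    using assms by (simp add: stripe_value.simps[of p G])
  moreover have "optimum p (?f ` p3_ends G) \<in> ?f ` p3_ends G"
    using assms by (intro optimum_mem) (auto simp: finite_p3_ends)
  ultimately obtain v where "v \<in> p3_ends G" "stripe_value p G = ?f v"
    by auto
  then show ?thesis
    using responder_choice[OF assms(1,2), of v "opponent p" p] by auto
qed

lemma stripe_value_Minimizer_le:
  assumes "wf_digraph G" and "finite (verts G)" and "v \<in> p3_ends G"
  shows "\<exists>(w, x) \<in> p3_from G v.
    stripe_value Minimizer G \<le> 1 + stripe_value Minimizer (G \<restriction> (verts G - {v, w, x}))"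
proof -
  let ?f = "\<lambda>v. optimum Maximizer
    ((\<lambda>(w, x). 1 + stripe_value Minimizer (G \<restriction> (verts G - {v, w, x}))) ` p3_from G v)"
  have "stripe_value Minimizer G = Min (?f ` p3_ends G)"
    using assms by (auto simp: stripe_value.simps[of Minimizer G])
  also have "\<dots> \<le> ?f v"
    using assms by (auto simp: finite_p3_ends)
  finally show ?thesis
    using responder_choice[OF assms, of Maximizer Minimizer] by (simp add: split_def) metis
qed

lemma p3_from_distinct_verts:
  assumes "wf_digraph G" and "irrefl (arcs_ends G)" and "(w, x) \<in> p3_from G v"
  shows "{v, w, x} \<subseteq> verts G" and "card {v, w, x} = 3"
proof -
  show "{v, w, x} \<subseteq> verts G"
    using assms by (auto simp: p3_from_def dest: wf_digraph.adj_in_verts)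
  have "v \<noteq> w" "w \<noteq> x" "x \<noteq> v"
    using assms by (auto simp: p3_from_def irrefl_def)
  then show "card {v, w, x} = 3"
    by auto
qed

text \<open>
  The copies of \<open>P\<^sub>3\<close> taken in an optimal play are pairwise disjoint; when there are enough of them
  to cover all vertices, they are the tiles. The relation \<open>R\<close> stays fixed while the graph shrinks
  during the play.
\<close>

lemma P3_tileable_if_all_taken:
  assumes "wf_digraph H" and "finite (verts H)" and "irrefl R" and "arcs_ends H \<subseteq> R"
    and "card (verts H) \<le> 3 * stripe_value p H"
  shows "P3_tileable R (verts H)"
  using assms
proof (induction "card (verts H)" arbitrary: H rule: less_induct)
  case less
  show ?case
  proof (cases "p3_ends H = {}")
    case True
    then have "stripe_value p H = 0"
      by (simp add: stripe_value.simps[of p H])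
    then have "verts H = {}"
      using less.prems by simp
    then show ?thesis
      by (simp add: P3_tileable_empty)
  next
    case False
    then obtain v w x where copy: "(w, x) \<in> p3_from H v"
      and val: "stripe_value p H = 1 + stripe_value p (H \<restriction> (verts H - {v, w, x}))"
      using stripe_value_attained less.prems(1,2) by blast
    let ?H' = "H \<restriction> (verts H - {v, w, x})"
    have "irrefl (arcs_ends H)"
      using less.prems(3,4) by (auto simp: irrefl_def)
    then have T: "{v, w, x} \<subseteq> verts H" "card {v, w, x} = 3"
      using p3_from_distinct_verts[OF less.prems(1) _ copy] by auto
    have "card (verts H) = card (verts ?H') + 3"
      using T less.prems(2) card_mono[OF less.prems(2) T(1)] by (simp add: card_Diff_subset)
    moreover have "arcs_ends ?H' \<subseteq> R"
      using less.prems(4) dominates_induce_subgraphD by fast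
    ultimately have "P3_tileable R (verts ?H')"
      using less.prems val
      by (intro less.hyps) (auto intro: wf_digraph.wellformed_induce_subgraph)
    then have "P3_tileable R (verts H - {v, w, x})"
      by simp
    moreover have "(v, w) \<in> R" "(w, x) \<in> R" "x \<noteq> v"
      using copy less.prems(4) by (auto simp: p3_from_def)
    ultimately show ?thesis
      using T(1) P3_tileable_insert by metis
  qed
qed

lemma minimizer_names_tile_end:
  assumes "wf_digraph G" and "finite (verts G)" and "irrefl (arcs_ends G)"
    and perfect: "card (verts G) = 3 * stripe_value Minimizer G" and "v \<in> p3_ends G"
  shows "\<exists>(w, x) \<in> p3_from G v. P3_tileable (arcs_ends G) (verts G - {v, w, x})"
proof -
  obtain w x where copy: "(w, x) \<in> p3_from G v"
    and val: "stripe_value Minimizer G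
      \<le> 1 + stripe_value Minimizer (G \<restriction> (verts G - {v, w, x}))"
    using stripe_value_Minimizer_le[OF assms(1,2,5)] by auto
  let ?G' = "G \<restriction> (verts G - {v, w, x})"
  note T = p3_from_distinct_verts[OF assms(1,3) copy]
  have "card (verts G) = card (verts ?G') + 3"
    using T assms(2) card_mono[OF assms(2) T(1)] by (simp add: card_Diff_subset)
  then have "card (verts ?G') \<le> 3 * stripe_value Minimizer ?G'"
    using perfect val by linarith
  moreover have "arcs_ends ?G' \<subseteq> arcs_ends G"
    using dominates_induce_subgraphD by fast
  ultimately have "P3_tileable (arcs_ends G) (verts ?G')"
    using assms by (intro P3_tileable_if_all_taken) (auto intro: wf_digraph.wellformed_induce_subgraph)
  then show ?thesis
    using copy by auto
qed

section \<open>Tilings of trees\<close>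

lemma graph_arcs_ends:
  assumes "graph G"
  shows "wf_digraph G" and "finite (verts G)" and "sym (arcs_ends G)" and "irrefl (arcs_ends G)"
proof -
  interpret graph G by fact
  show "wf_digraph G" "finite (verts G)"
    by (auto intro: wf_digraph)
  show "sym (arcs_ends G)"
    using sym_arcs by (simp add: symmetric_def)
  show "irrefl (arcs_ends G)"
    by (auto simp: irrefl_def dest: adj_not_same)
qed

text \<open>
  Take for \<open>S\<close> the vertices reachable from \<open>a\<close> without passing through \<open>c\<close>. An edge leaving \<open>S\<close>
  can only end in \<open>c\<close>, and if it started at some \<open>u \<noteq> a\<close>, then a path from \<open>a\<close> to \<open>u\<close> inside \<open>S\<close>
  would form a cycle with \<open>c\<close>. So the edge \<open>a - c\<close> is a bridge and \<open>S\<close> is its side containing \<open>a\<close>.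
\<close>

lemma tree_arc_separates:
  assumes tree: "undirected_tree G" and ac: "a \<rightarrow>\<^bsub>G\<^esub> c"
  obtains S where "a \<in> S" and "c \<notin> S"
    and "\<And>u v. u \<rightarrow>\<^bsub>G\<^esub> v \<Longrightarrow> u \<in> S \<Longrightarrow> v \<notin> S \<Longrightarrow> u = a \<and> v = c"
proof -
  have "graph G" and acyclic: "\<And>p. pre_digraph.cycle G p \<Longrightarrow> \<not> length p \<ge> 3"
    using tree by (auto simp: undirected_tree_def)
  interpret graph G by fact
  let ?H = "G \<restriction> (verts G - {c})"
  interpret H: wf_digraph ?H
    by (rule wellformed_induce_subgraph)
  define S where "S = {u. a \<rightarrow>\<^sup>*\<^bsub>?H\<^esub> u}"
  have "a \<noteq> c"
    using ac adj_not_same by auto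
  have "a \<in> S"
    using ac \<open>a \<noteq> c\<close> by (auto simp: S_def dest: adj_in_verts)
  moreover have S_verts: "S \<subseteq> verts G - {c}"
  proof
    fix u
    assume "u \<in> S"
    then have "u \<in> verts ?H"
      unfolding S_def by (intro H.reachable_in_verts(2)[of a u]) simp
    then show "u \<in> verts G - {c}"
      by simp
  qed
  moreover have "u = a \<and> v = c" if uv: "u \<rightarrow>\<^bsub>G\<^esub> v" and "u \<in> S" "v \<notin> S" for u v
  proof
    show "v = c"
    proof (rule ccontr)
      assume "v \<noteq> c"
      then have "u \<rightarrow>\<^bsub>?H\<^esub> v"
        using uv S_verts \<open>u \<in> S\<close> by (auto simp: arcs_ends_conv)
      then have "v \<in> S"
        using \<open>u \<in> S\<close> by (auto simp: S_def intro: H.reachable_adj_trans)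
      with \<open>v \<notin> S\<close> show False by simp
    qed
    show "u = a"
    proof (rule ccontr)
      assume "u \<noteq> a"
      obtain p where p: "H.apath a p u"
        using \<open>u \<in> S\<close> H.reachable_apath by (auto simp: S_def)
      have sub: "subgraph ?H G"
        by (rule subgraph_induce_subgraphI) auto
      have Gp: "apath a p u"
        using subgraph_apath_imp_apath[OF p sub] .
      have "awalk_verts a p = H.awalk_verts a p"
        using sub compatible_awalk_verts[of G ?H] by auto
      moreover have "set (H.awalk_verts a p) \<subseteq> verts ?H"
        using p unfolding H.apath_def H.awalk_conv by blast
      ultimately have avoids: "c \<notin> set (awalk_verts a p)"
        by auto
      obtain e where e: "e \<in> arcs G" "tail G e = c" "head G e = a"
        using arcs_ends_symmetric[OF sym_arcs ac] by auto
      obtain f where f: "f \<in> arcs G" "tail G f = u" "head G f = c"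
        using uv \<open>v = c\<close> by auto
      have walk: "awalk a p u" "distinct (awalk_verts a p)"
        using Gp by (simp_all add: apath_def)
      have last: "awlast a p = u"
        using walk(1) unfolding awalk_conv by blast
      have closing: "awalk a (p @ [f]) c"
        using walk f last head_in_verts[of f] by (simp add: awalk_simps)
      have "awalk_verts a (p @ [f]) = awalk_verts a p @ [c]"
        using awalk_verts_append[OF closing] f last by simp
      then have "cycle (e # p @ [f])"
        using e closing walk avoids unfolding cycle_def
        by (intro exI[of _ c]) (simp add: awalk_Cons_iff del: awalk_append_iff)
      moreover have "p \<noteq> []"
        using walk(1) \<open>u \<noteq> a\<close> by (metis awalk_empty_ends)
      then have "length (e # p @ [f]) \<ge> 3"
        by (cases p) auto
      ultimately show False
        using acyclic by blast
    qed
  qed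
  ultimately show thesis
    using that by blast
qed

lemma tree_no_triangle:
  assumes tree: "undirected_tree G" and "u \<rightarrow>\<^bsub>G\<^esub> v" and "v \<rightarrow>\<^bsub>G\<^esub> w" and "u \<rightarrow>\<^bsub>G\<^esub> w"
  shows False
proof -
  note G = graph_arcs_ends[of G]
  have *: "sym (arcs_ends G)" "irrefl (arcs_ends G)"
    using tree G by (auto simp: undirected_tree_def)
  obtain S where S: "u \<in> S" "v \<notin> S"
    "\<And>x y. x \<rightarrow>\<^bsub>G\<^esub> y \<Longrightarrow> x \<in> S \<Longrightarrow> y \<notin> S \<Longrightarrow> x = u \<and> y = v"
    using tree_arc_separates[OF tree assms(2)] by metis
  show False
  proof (cases "w \<in> S")
    case True
    then show ?thesis
      using S(2) S(3)[of w v] assms * by (auto simp: irrefl_def dest: symD)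
  next
    case False
    then show ?thesis
      using S(1) S(3)[of u w] assms * by (auto simp: irrefl_def)
  qed
qed

text \<open>
  Count the side of \<open>a\<close> modulo 3: according to the tiling with tile \<open>a - c - b\<close> it consists of \<open>a\<close>
  and full tiles, whereas a tile \<open>c - w - x\<close> with \<open>w \<noteq> a\<close> lies on the other side together with \<open>c\<close>,
  so according to a tiling containing it the side of \<open>a\<close> consists of full tiles only.
\<close>

lemma tile_uses_edge:
  assumes tree: "undirected_tree G"
    and tile: "a \<rightarrow>\<^bsub>G\<^esub> c" "c \<rightarrow>\<^bsub>G\<^esub> b" "a \<noteq> b"
    and tiling: "P3_tileable (arcs_ends G) (verts G - {a, c, b})"
    and tile': "c \<rightarrow>\<^bsub>G\<^esub> w" "w \<rightarrow>\<^bsub>G\<^esub> x" "x \<noteq> c"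
    and tiling': "P3_tileable (arcs_ends G) (verts G - {c, w, x})"
  shows "w = a"
proof (rule ccontr)
  assume "w \<noteq> a"
  have G: "wf_digraph G" "finite (verts G)" "sym (arcs_ends G)" "irrefl (arcs_ends G)"
    using tree graph_arcs_ends by (auto simp: undirected_tree_def)
  obtain S where S: "a \<in> S" "c \<notin> S"
    and out: "\<And>u v. u \<rightarrow>\<^bsub>G\<^esub> v \<Longrightarrow> u \<in> S \<Longrightarrow> v \<notin> S \<Longrightarrow> u = a \<and> v = c"
    using tree_arc_separates[OF tree tile(1)] by metis
  have inside: "u \<in> S \<longleftrightarrow> v \<in> S" if "u \<rightarrow>\<^bsub>G\<^esub> v" "u \<noteq> c" "v \<noteq> c" for u v
    using that out[of u v] out[of v u] G(3) by (auto dest: symD)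
  have avoiding: "3 dvd card ((verts G - T) \<inter> S)"
    if "P3_tileable (arcs_ends G) (verts G - T)" and "c \<in> T" for T
    using that G(2,4) inside by (intro P3_tileable_card_closed) auto
  have "b \<notin> S"
    using out[of b c] tile G(3) S by (auto dest: symD)
  have "a \<in> verts G"
    using tile(1) wf_digraph.adj_in_verts[OF G(1)] by auto
  then have "verts G \<inter> S = insert a ((verts G - {a, c, b}) \<inter> S)"
    using S \<open>b \<notin> S\<close> by auto
  then have "card (verts G \<inter> S) = Suc (card ((verts G - {a, c, b}) \<inter> S))"
    using G(2) by simp
  moreover have "3 dvd card ((verts G - {a, c, b}) \<inter> S)"
    using avoiding[OF tiling] by simp
  moreover have "w \<notin> S"
    using out[of w c] tile' G(3) S \<open>w \<noteq> a\<close> by (auto dest: symD)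
  then have "x \<notin> S"
    using inside[of w x] tile' G(4) by (auto simp: irrefl_def)
  then have "(verts G - {c, w, x}) \<inter> S = verts G \<inter> S"
    using S \<open>w \<notin> S\<close> by auto
  then have "3 dvd card (verts G \<inter> S)"
    using avoiding[OF tiling'] by simp
  ultimately show False
    by presburger
qed

lemma tile_centre_not_tile_end:
  assumes tree: "undirected_tree G"
    and tile: "a \<rightarrow>\<^bsub>G\<^esub> c" "c \<rightarrow>\<^bsub>G\<^esub> b" "a \<noteq> b"
    and tiling: "P3_tileable (arcs_ends G) (verts G - {a, c, b})"
    and copy: "(w, x) \<in> p3_from G c"
  shows "\<not> P3_tileable (arcs_ends G) (verts G - {c, w, x})"
proof
  assume tiling': "P3_tileable (arcs_ends G) (verts G - {c, w, x})"
  have tile': "c \<rightarrow>\<^bsub>G\<^esub> w" "w \<rightarrow>\<^bsub>G\<^esub> x" "x \<noteq> c"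
    using copy by (auto simp: p3_from_def)
  have "sym (arcs_ends G)"
    using tree graph_arcs_ends by (auto simp: undirected_tree_def)
  then have reversed: "b \<rightarrow>\<^bsub>G\<^esub> c" "c \<rightarrow>\<^bsub>G\<^esub> a" "b \<noteq> a"
    using tile by (simp_all add: symD)
  have "P3_tileable (arcs_ends G) (verts G - {b, c, a})"
    using tiling by (simp add: insert_commute)
  then have "w = b"
    using tile_uses_edge[OF tree reversed] tile' tiling' by blast
  moreover have "w = a"
    using tile_uses_edge[OF tree tile tiling tile' tiling'] .
  ultimately show False
    using \<open>a \<noteq> b\<close> by simp
qed

lemma connected_graph_leaves_set:
  assumes "graph G" and "connected G" and "T \<subseteq> verts G" and "T \<noteq> {}" and "T \<noteq> verts G"
  obtains u v where "u \<rightarrow>\<^bsub>G\<^esub> v" and "u \<in> T" and "v \<in> verts G - T"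
proof -
  interpret graph G by fact
  obtain t y where t: "t \<in> T" and y: "y \<in> verts G - T"
    using assms(3-5) by blast
  have "strongly_connected G"
    using assms(2) sym_arcs by (intro symmetric_connected_imp_strongly_connected)
  then have "t \<rightarrow>\<^sup>*\<^bsub>G\<^esub> y"
    using t y assms(3) by (auto simp: strongly_connected_def)
  then have "\<exists>u v. u \<rightarrow>\<^bsub>G\<^esub> v \<and> u \<in> T \<and> v \<in> verts G - T"
    using t y
  proof (induction rule: converse_reachable_induct)
    case (step u v)
    then show ?case
      by (cases "v \<in> T") (auto dest: adj_in_verts)
  qed simp
  then show thesis
    using that by blast
qed

text \<open>
  Some edge leaves the tile. If it starts at an end of the tile, it completes a path from the
  centre; if it starts at the centre, its other endpoint lies in another tile and has a further
  neighbour there.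
\<close>

lemma tile_centre_in_p3_ends:
  assumes "graph G" and "connected G"
    and tile: "a \<rightarrow>\<^bsub>G\<^esub> c" "c \<rightarrow>\<^bsub>G\<^esub> b"
    and tiling: "P3_tileable (arcs_ends G) (verts G - {a, c, b})"
    and "verts G \<noteq> {a, c, b}"
  shows "c \<in> p3_ends G"
proof -
  note G = graph_arcs_ends[OF \<open>graph G\<close>]
  have T: "{a, c, b} \<subseteq> verts G"
    using tile wf_digraph.adj_in_verts[OF G(1)] by blast
  obtain u y where uy: "u \<rightarrow>\<^bsub>G\<^esub> y" "u \<in> {a, c, b}" "y \<in> verts G - {a, c, b}"
    using connected_graph_leaves_set[OF assms(1,2) T] assms(6) by blast
  have "\<exists>w x. c \<rightarrow>\<^bsub>G\<^esub> w \<and> w \<rightarrow>\<^bsub>G\<^esub> x \<and> x \<noteq> c"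
  proof (cases "u = c")
    case True
    obtain z where "z \<in> verts G - {a, c, b}" "y \<rightarrow>\<^bsub>G\<^esub> z"
      using P3_tileable_neighbour[OF tiling G(3) uy(3)] by blast
    then show ?thesis
      using True uy by auto
  next
    case False
    then have "c \<rightarrow>\<^bsub>G\<^esub> u"
      using uy tile G(3) by (auto dest: symD)
    then show ?thesis
      using uy by auto
  qed
  then show ?thesis
    using T by (auto simp: p3_ends_def p3_from_def)
qed

section \<open>The graph \<open>P\<^sub>3\<close>\<close>

text \<open>The argument \<open>c\<close> between \<open>a\<close> and \<open>b\<close> is the centre of the path.\<close>

definition path3_on :: "('a, 'b) pre_digraph \<Rightarrow> 'a \<Rightarrow> 'a \<Rightarrow> 'a \<Rightarrow> bool" where
  "path3_on G a c b \<longleftrightarrow> distinct [a, c, b] \<and> verts G = {a, c, b} \<and>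
     arcs_ends G = {(a, c), (c, a), (c, b), (b, c)}"

text \<open>
  Without parallel arcs, arcs can be identified with the pairs of their endpoints, which are the
  arcs of \<^const>\<open>P3\<close>.
\<close>

lemma digraph_iso_P3_if_path3_on:
  assumes "nomulti_digraph G" and path: "path3_on G a c b"
  shows "digraph_iso G P3"
proof -
  interpret nomulti_digraph G by fact
  have dist: "a \<noteq> c" "a \<noteq> b" "c \<noteq> b" and V: "verts G = {a, c, b}"
    and E: "arcs_ends G = {(a, c), (c, a), (c, b), (b, c)}"
    using path by (auto simp: path3_on_def)
  define \<phi> :: "'a \<Rightarrow> nat" where "\<phi> u = (if u = a then 0 else if u = c then 1 else 2)" for u
  define hom where "hom = \<lparr>iso_verts = \<phi>, iso_arcs = (\<lambda>e. map_prod \<phi> \<phi> (arc_to_ends G e)),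
    iso_head = snd, iso_tail = fst\<rparr>"
  have inj: "inj_on \<phi> (verts G)"
    using dist by (auto simp: inj_on_def \<phi>_def V)
  have "inj_on (\<lambda>e. map_prod \<phi> \<phi> (arc_to_ends G e)) (arcs G)"
  proof (rule inj_onI)
    fix e f
    assume "e \<in> arcs G" "f \<in> arcs G"
      and "map_prod \<phi> \<phi> (arc_to_ends G e) = map_prod \<phi> \<phi> (arc_to_ends G f)"
    then show "e = f"
      using inj by (intro no_multi_arcs) (auto simp: arc_to_ends_def inj_on_eq_iff)
  qed
  then have "digraph_isomorphism hom"
    using inj wf_digraph by (auto simp: digraph_isomorphism_def hom_def arc_to_ends_def)
  moreover have "with_proj P3 = app_iso hom G"
  proof -
    have "iso_arcs hom ` arcs G = map_prod \<phi> \<phi> ` arcs_ends G"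
      by (auto simp: hom_def arcs_ends_def image_image)
    also have "\<dots> = parcs P3"
      using dist by (simp add: E \<phi>_def P3_def)
    finally have "iso_arcs hom ` arcs G = parcs P3" .
    moreover have "iso_verts hom ` verts G = pverts P3"
      using dist by (auto simp: hom_def V \<phi>_def P3_def)
    ultimately show ?thesis
      by (simp add: app_iso_def with_proj_def) (simp add: hom_def)
  qed
  ultimately show ?thesis
    by (auto simp: digraph_iso_def)
qed

lemma path3_on_if_digraph_iso_P3:
  assumes "digraph_iso G P3"
  shows "nomulti_digraph G \<and> (\<exists>a c b. path3_on G a c b)"
proof -
  obtain hom where iso: "pre_digraph.digraph_isomorphism G hom" and img: "with_proj P3 = app_iso hom G"
    using assms by (auto simp: digraph_iso_def)
  interpret wf_digraph G
    using iso by (auto simp: pre_digraph.digraph_isomorphism_def)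
  let ?\<phi> = "iso_verts hom"
  have inj: "inj_on ?\<phi> (verts G)" and inj_arcs: "inj_on (iso_arcs hom) (arcs G)"
    using iso by (auto simp: digraph_isomorphism_def)
  have V: "?\<phi> ` verts G = {0, 1, 2}" and A: "iso_arcs hom ` arcs G = parcs P3"
    and proj: "iso_tail hom = fst" "iso_head hom = snd"
    using arg_cong[OF img, of verts] arg_cong[OF img, of arcs]
      arg_cong[OF img, of tail] arg_cong[OF img, of head]
    by (auto simp: P3_def)
  have arc: "iso_arcs hom e = map_prod ?\<phi> ?\<phi> (arc_to_ends G e)" if "e \<in> arcs G" for e
    using that iso proj by (auto simp: digraph_isomorphism_def arc_to_ends_def prod_eq_iff)
  have nomulti: "nomulti_digraph G"
    using arc inj_arcs by unfold_locales (metis inj_onD)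
  have "k \<in> {0, 1, 2} \<Longrightarrow> \<exists>u \<in> verts G. ?\<phi> u = k" for k
    unfolding V[symmetric] by blast
  from this[of 0] this[of 1] this[of 2] obtain a c b where
    abc: "a \<in> verts G" "c \<in> verts G" "b \<in> verts G" "?\<phi> a = 0" "?\<phi> c = 1" "?\<phi> b = 2"
    by (simp only: insert_iff simp_thms) blast
  have ends: "arcs_ends G \<subseteq> verts G \<times> verts G"
    using adj_in_verts by (intro subrelI) blast
  have "map_prod ?\<phi> ?\<phi> ` arcs_ends G = iso_arcs hom ` arcs G"
    unfolding arcs_ends_def image_image using arc by (intro image_cong) simp_all
  also have "\<dots> = map_prod ?\<phi> ?\<phi> ` {(a, c), (c, a), (c, b), (b, c)}"
    using abc by (simp add: A P3_def)
  finally have "arcs_ends G = {(a, c), (c, a), (c, b), (b, c)}"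
    using abc(1-3)
    by (subst (asm) inj_on_image_eq_iff[OF map_prod_inj_on[OF inj inj] ends]) simp_all
  moreover have "?\<phi> ` verts G = ?\<phi> ` {a, c, b}"
    using abc by (simp add: V)
  then have "verts G = {a, c, b}"
    using abc(1-3) by (subst (asm) inj_on_image_eq_iff[OF inj]) simp_all
  ultimately show ?thesis
    using nomulti abc(4-6) by (intro conjI exI[of _ a] exI[of _ c] exI[of _ b]) (auto simp: path3_on_def)
qed

lemma undirected_tree_if_path3_on:
  assumes "nomulti_digraph G" and path: "path3_on G a c b"
  shows "undirected_tree G"
proof -
  interpret nomulti_digraph G by fact
  have dist: "a \<noteq> c" "a \<noteq> b" "c \<noteq> b" and V: "verts G = {a, c, b}"
    and E: "arcs_ends G = {(a, c), (c, a), (c, b), (b, c)}"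
    using path by (auto simp: path3_on_def)
  have "finite (arc_to_ends G ` arcs G)"
    using E by (simp add: arcs_ends_def)
  then have "finite (arcs G)"
    using inj_on_arc_to_ends finite_imageD by blast
  moreover have arc: "(tail G e, head G e) \<in> {(a, c), (c, a), (c, b), (b, c)}" if "e \<in> arcs G" for e
    using that unfolding E[symmetric] arcs_ends_conv by blast
  then have "tail G e \<noteq> head G e" if "e \<in> arcs G" for e
    using that dist by fastforce
  moreover have sym: "symmetric G"
    by (auto simp: symmetric_def sym_def E)
  ultimately have "graph G"
    using V by unfold_locales auto
  interpret graph G by fact
  have "connected G"
    unfolding connected_conv
  proof (intro conjI ballI)
    fix u v
    assume "u \<in> verts G" "v \<in> verts G"
    moreover have steps: "a \<rightarrow>\<^bsub>G\<^esub> c" "c \<rightarrow>\<^bsub>G\<^esub> a" "c \<rightarrow>\<^bsub>G\<^esub> b" "b \<rightarrow>\<^bsub>G\<^esub> c"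
      using E by auto
    ultimately have "u \<rightarrow>\<^sup>*\<^bsub>G\<^esub> c" "c \<rightarrow>\<^sup>*\<^bsub>G\<^esub> v"
      using V by auto
    then have "u \<rightarrow>\<^sup>*\<^bsub>G\<^esub> v"
      by (rule reachable_trans)
    then show "(u, v) \<in> rtrancl_on (verts G) ((arcs_ends G)\<^sup>s)"
      unfolding reachable_def by (rule rtrancl_on_mono[rotated -1]) (auto simp: symcl_def)
  qed (simp add: V)
  moreover have False if "cycle p" and "length p \<ge> 3" for p
  proof -
    obtain u where u: "awalk u p u" "distinct (tl (awalk_verts u p))"
      using \<open>cycle p\<close> by (auto simp: cycle_def)
    \<comment> \<open>The vertices passed are distinct, so \<open>p\<close> would be a triangle, but \<open>a\<close> and \<open>b\<close> are not adjacent.\<close>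
    have "set (tl (awalk_verts u p)) \<subseteq> verts G"
      using u(1) by (cases "awalk_verts u p") (simp_all add: awalk_conv)
    then have "length (tl (awalk_verts u p)) \<le> card (verts G)"
      using u(2) distinct_card card_mono[OF finite_verts] by metis
    then have "length p = 3"
      using dist V \<open>length p \<ge> 3\<close> by (simp add: awalk_verts_conv split: if_splits)
    then obtain e\<^sub>1 e\<^sub>2 e\<^sub>3 where p: "p = [e\<^sub>1, e\<^sub>2, e\<^sub>3]"
      by (auto simp: numeral_3_eq_3 length_Suc_conv)
    show False
      using u dist arc[of e\<^sub>1] arc[of e\<^sub>2] arc[of e\<^sub>3] by (auto simp: p awalk_simps)
  qed
  ultimately show ?thesis
    using \<open>graph G\<close> by (auto simp: undirected_tree_def)
qed

lemma stripe_value_path3_on: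
  assumes "wf_digraph G" and path: "path3_on G a c b"
  shows "stripe_value p G = 1"
proof -
  have dist: "a \<noteq> c" "a \<noteq> b" "c \<noteq> b" and V: "verts G = {a, c, b}"
    and E: "arcs_ends G = {(a, c), (c, a), (c, b), (b, c)}"
    using path by (auto simp: path3_on_def)
  have "(c, b) \<in> p3_from G a"
    using dist E by (auto simp: p3_from_def)
  then have "p3_ends G \<noteq> {}"
    using V by (auto simp: p3_ends_def)
  then obtain v w x where copy: "(w, x) \<in> p3_from G v"
    and val: "stripe_value p G = 1 + stripe_value p (G \<restriction> (verts G - {v, w, x}))"
    using stripe_value_attained[OF assms(1), of p] V by auto
  have "irrefl (arcs_ends G)"
    using dist E by (auto simp: irrefl_def)
  note T = p3_from_distinct_verts[OF assms(1) this copy]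
  have "{v, w, x} = verts G"
    using T dist V by (intro card_subset_eq) auto
  then have "p3_ends (G \<restriction> (verts G - {v, w, x})) = {}"
    by (auto simp: p3_ends_def)
  then show ?thesis
    using val by (simp add: stripe_value.simps[of p "G \<restriction> (verts G - {v, w, x})"])
qed

section \<open>Perfect trees\<close>

lemma perfect_tree_is_path3:
  assumes tree: "undirected_tree G"
    and perfect: "card (verts G) = 3 * stripe_value Minimizer G"
  shows "\<exists>a c b. path3_on G a c b"
proof -
  have "graph G" and conn: "connected G"
    using tree by (auto simp: undirected_tree_def)
  note G = graph_arcs_ends[OF \<open>graph G\<close>]
  have "verts G \<noteq> {}"
    using conn by (simp add: connected_conv)
  have "P3_tileable (arcs_ends G) (verts G)"
    using G perfect by (intro P3_tileable_if_all_taken) auto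
  then obtain a c b where tile: "a \<rightarrow>\<^bsub>G\<^esub> c" "c \<rightarrow>\<^bsub>G\<^esub> b" "a \<noteq> b"
    and tiling: "P3_tileable (arcs_ends G) (verts G - {a, c, b})"
    using \<open>verts G \<noteq> {}\<close> by (cases rule: P3_tileable.cases) auto
  have V: "verts G = {a, c, b}"
  proof (rule ccontr)
    assume "verts G \<noteq> {a, c, b}"
    then have "c \<in> p3_ends G"
      using tile_centre_in_p3_ends[OF \<open>graph G\<close> conn tile(1,2) tiling] by simp
    then show False
      using minimizer_names_tile_end[OF G(1,2,4) perfect]
        tile_centre_not_tile_end[OF tree tile tiling] by blast
  qed
  have "(a, b) \<notin> arcs_ends G"
    using tree_no_triangle[OF tree tile(1,2)] by blast
  moreover have "arcs_ends G \<subseteq> verts G \<times> verts G"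
    using wf_digraph.adj_in_verts[OF G(1)] by auto
  ultimately have "arcs_ends G = {(a, c), (c, a), (c, b), (b, c)}"
    using tile G(3,4) V by (auto simp: irrefl_def dest: symD)
  moreover have "distinct [a, c, b]"
    using tile G(4) by (auto simp: irrefl_def)
  ultimately show ?thesis
    using V by (auto simp: path3_on_def)
qed

theorem lemma9:
  fixes G :: "('a, 'b) pre_digraph"
  shows "undirected_tree G \<and> stripe_perfect Minimizer G \<longleftrightarrow> digraph_iso G P3"
proof
  assume *: "undirected_tree G \<and> stripe_perfect Minimizer G"
  then have "card (verts G) = 3 * stripe_value Minimizer G"
    unfolding stripe_perfect_def by linarith
  then obtain a c b where "path3_on G a c b"
    using * perfect_tree_is_path3 by blast
  moreover have "nomulti_digraph G"
    using * by (auto simp: undirected_tree_def graph_def digraph_def)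
  ultimately show "digraph_iso G P3"
    by (intro digraph_iso_P3_if_path3_on)
next
  assume "digraph_iso G P3"
  then obtain a c b where "nomulti_digraph G" and path: "path3_on G a c b"
    using path3_on_if_digraph_iso_P3 by blast
  moreover have "card (verts G) = 3"
    using path by (auto simp: path3_on_def)
  moreover have "stripe_value Minimizer G = 1"
    using \<open>nomulti_digraph G\<close> path
    by (intro stripe_value_path3_on) (auto simp: nomulti_digraph_def)
  ultimately show "undirected_tree G \<and> stripe_perfect Minimizer G"
    using undirected_tree_if_path3_on by (auto simp: stripe_perfect_def)
qed

end
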